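(* Let $k\geq 3$ and let $P:\{0,1\}^k\to\{0,1\}$ be a symmetric predicate other than $k$-EQU. Then for any $\epsilon>0$ and any predicate $Q:\{0,1\}^k\to\{0,1\}$ with $P^{-1}(1)\subseteq Q^{-1}(1)$, there exists $d=O(1/\epsilon^2)$ such that every one-sided error $(|Q^{-1}(0)|/2^k-\epsilon)$-tester for CSP($Q$) with degree bound $d$ requires $\Omega(n)$ queries, where $n$ is the number of variables.
   Context: All predicates satisfy $|P^{-1}(1)|>0$. A predicate $P:\{0,1\}^k\to\{0,1\}$ is symmetric if (i) $P(x)=P(y)$ whenever $x,y$ have the same Hamming weight and (ii) $P(x)=P(\overline{x})$ for all $x$, where $\overline{x}=(1,\dots,1)-x$. $k$-EQU is the predicate satisfied iff all $k$ inputs are equal. An instance of CSP($Q$) consists of Boolean variables and constraints, each on a $k$-tuple of variables $(x_1,\dots,x_k)$ and of the form $Q(x_1+b_1,\dots,x_k+b_k)=1$ for some $b\in\{0,1\}^k$ (addition mod 2). Bounded-degree model with degree bound $d$: each variable appears in at most $d$ constraints; an algorithm accesses the instance only via an oracle that, given a variable $x$ and an index $1\le i\le d$, returns the $i$-th constraint containing $x$ (or a special symbol if none exists); query complexity is the number of oracle calls. An instance is $\epsilon$-far from satisfiability if at least $\epsilon dn/k$ constraints must be removed to make it satisfiable. An $\epsilon$-tester is a randomized algorithm that accepts every satisfiable instance with probability at least $2/3$ and rejects every instance $\epsilon$-far from satisfiability with probability at least $2/3$; it is one-sided error if it accepts every satisfiable instance with probability $1$. *)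

theory Defs
  imports "HOL-Probability.Probability"
begin

text \<open>
  The arity $k$ is the cardinality of the finite index type \<open>'k\<close>; points of $\{0,1\}^k$ are functions
  \<open>'k \<Rightarrow> bool\<close>, and addition mod 2 is inequality of Booleans.
\<close>

type_synonym 'k predicate = "('k \<Rightarrow> bool) \<Rightarrow> bool"

definition hamming_weight :: "('k::finite \<Rightarrow> bool) \<Rightarrow> nat" where
  "hamming_weight x = card {i. x i}"

definition symmetric_predicate :: "('k::finite) predicate \<Rightarrow> bool" where
  "symmetric_predicate P \<longleftrightarrow>
     (\<forall>x y. hamming_weight x = hamming_weight y \<longrightarrow> P x = P y) \<and>
     (\<forall>x. P x = P (\<lambda>i. \<not> x i))"

definition EQU :: "('k::finite) predicate" where
  "EQU x \<longleftrightarrow> (\<forall>i j. x i = x j)"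

text \<open>
  A constraint \<open>(v, b)\<close> stands for $Q(x_{v_1} + b_1, \dots, x_{v_k} + b_k) = 1$.
  The variables of an instance on \<open>n\<close> variables are the numbers below \<open>n\<close>.
  The entries of the tuple \<open>v\<close> need not be distinct.
\<close>

type_synonym 'k constr = "('k \<Rightarrow> nat) \<times> ('k \<Rightarrow> bool)"

definition constr_vars :: "('k::finite) constr \<Rightarrow> nat set" where
  "constr_vars c = range (fst c)"

definition satisfies :: "('k::finite) predicate \<Rightarrow> (nat \<Rightarrow> bool) \<Rightarrow> 'k constr \<Rightarrow> bool" where
  "satisfies Q \<sigma> c \<longleftrightarrow> Q (\<lambda>i. \<sigma> (fst c i) \<noteq> snd c i)"

definition satisfiable :: "('k::finite) predicate \<Rightarrow> 'k constr set \<Rightarrow> bool" where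
  "satisfiable Q C \<longleftrightarrow> (\<exists>\<sigma>. \<forall>c\<in>C. satisfies Q \<sigma> c)"

text \<open>
  An instance carries, for each variable, an enumeration of the constraints containing it. The
  enumerations at different variables are unrelated; they fix what ``the \<open>i\<close>-th constraint
  containing \<open>x\<close>'' means.
\<close>

record 'k csp =
  constraints :: "'k constr set"
  incidence :: "nat \<Rightarrow> 'k constr list"

definition csp_instances :: "nat \<Rightarrow> nat \<Rightarrow> ('k::finite) csp set" where
  "csp_instances d n =
     {I. (\<forall>c\<in>constraints I. constr_vars c \<subseteq> {..<n}) \<and>
         (\<forall>x. distinct (incidence I x) \<and>
              set (incidence I x) = {c \<in> constraints I. x \<in> constr_vars c}) \<and>
         (\<forall>x<n. card {c \<in> constraints I. x \<in> constr_vars c} \<le> d)}"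

definition far_from_satisfiable ::
    "('k::finite) predicate \<Rightarrow> real \<Rightarrow> nat \<Rightarrow> nat \<Rightarrow> 'k csp \<Rightarrow> bool" where
  "far_from_satisfiable Q \<epsilon> d n I \<longleftrightarrow>
     (\<forall>R \<subseteq> constraints I. satisfiable Q (constraints I - R) \<longrightarrow>
        \<epsilon> * real d * real n / real CARD('k) \<le> real (card R))"

text \<open>Indices are counted from 1; \<open>None\<close> is the special symbol for a missing constraint.\<close>

definition oracle_of :: "('k::finite) csp \<Rightarrow> nat \<Rightarrow> nat \<Rightarrow> 'k constr option" where
  "oracle_of I x i =
     (if 1 \<le> i \<and> i \<le> length (incidence I x) then Some (incidence I x ! (i - 1)) else None)"

text \<open>
  A deterministic adaptive query algorithm is a decision tree, and a randomized one is a
  probability distribution on decision trees. Nothing but the number of queries is restricted; in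
  particular a tree may be tailored to \<open>n\<close>, \<open>d\<close>, \<open>Q\<close> and \<open>\<epsilon>\<close>.
  \<open>Output True\<close> means acceptance.
\<close>

datatype (dead 'k) decision_tree =
    Output bool
  | Query nat nat "'k constr option \<Rightarrow> 'k decision_tree"

primrec accepts :: "(nat \<Rightarrow> nat \<Rightarrow> 'k constr option) \<Rightarrow> 'k decision_tree \<Rightarrow> bool" where
  "accepts f (Output b) = b"
| "accepts f (Query x i t) = accepts f (t (f x i))"

primrec num_queries :: "(nat \<Rightarrow> nat \<Rightarrow> 'k constr option) \<Rightarrow> 'k decision_tree \<Rightarrow> nat" where
  "num_queries f (Output b) = 0"
| "num_queries f (Query x i t) = Suc (num_queries f (t (f x i)))"

definition accept_prob :: "('k::finite) decision_tree pmf \<Rightarrow> 'k csp \<Rightarrow> real" where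
  "accept_prob A I = measure_pmf.prob A {t. accepts (oracle_of I) t}"

definition reject_prob :: "('k::finite) decision_tree pmf \<Rightarrow> 'k csp \<Rightarrow> real" where
  "reject_prob A I = measure_pmf.prob A {t. \<not> accepts (oracle_of I) t}"

definition tester ::
    "('k::finite) predicate \<Rightarrow> real \<Rightarrow> nat \<Rightarrow> nat \<Rightarrow> 'k decision_tree pmf \<Rightarrow> bool" where
  "tester Q \<epsilon> d n A \<longleftrightarrow>
     (\<forall>I \<in> csp_instances d n.
        (satisfiable Q (constraints I) \<longrightarrow> accept_prob A I \<ge> 2 / 3) \<and>
        (far_from_satisfiable Q \<epsilon> d n I \<longrightarrow> reject_prob A I \<ge> 2 / 3))"

definition one_sided_tester ::
    "('k::finite) predicate \<Rightarrow> real \<Rightarrow> nat \<Rightarrow> nat \<Rightarrow> 'k decision_tree pmf \<Rightarrow> bool" where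
  "one_sided_tester Q \<epsilon> d n A \<longleftrightarrow>
     tester Q \<epsilon> d n A \<and>
     (\<forall>I \<in> csp_instances d n. satisfiable Q (constraints I) \<longrightarrow> accept_prob A I = 1)"

text \<open>Worst case over instances and over the random choices of the algorithm; it may be infinite.\<close>

definition query_complexity :: "nat \<Rightarrow> nat \<Rightarrow> ('k::finite) decision_tree pmf \<Rightarrow> enat" where
  "query_complexity d n A =
     (SUP I \<in> csp_instances d n. SUP t \<in> set_pmf A. enat (num_queries (oracle_of I) t))"

end

theory Submission
  imports Defs "HOL-Combinatorics.Permutations"
begin

text \<open>
  Overlay $d = O(1/\epsilon^2)$ random partitions of the variables into blocks of size $k$. By a first
  moment bound, any $s \le cn$ of the blocks cover more than $(k - 3/2)s$ variables, so among them
  some block has at most two variables in common with the others. A symmetric \<open>P\<close> other than \<open>EQU\<close>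
  accepts some weight strictly between $0$ and $k$ together with its complementary weight, hence any
  values of two inputs extend to an input accepted by \<open>P\<close>; peeling off such blocks one by one
  satisfies any $cn$ constraints, whatever their negations. Suitable negations on the other hand make
  every assignment violate almost a fraction $|Q^{-1}(0)|/2^k$ of all constraints. Finally, after
  fewer than $cn$ queries the negations of the unseen constraints can be changed so that the whole
  instance becomes satisfiable, which a one-sided tester must accept.
\<close>

subsection \<open>Decision trees and unseen constraints\<close>

text \<open>\<open>D\<close> collects the queries along the path that \<open>t\<close> follows under
  \<open>f\<close>; an oracle giving the same answers there is led along the same path.\<close>

lemma decision_tree_depends_on:
  "\<exists>D. finite D \<and> card D \<le> num_queries f t \<and>
       (\<forall>g. (\<forall>(x, i)\<in>D. g x i = f x i) \<longrightarrow> accepts g t = accepts f t)"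
proof (induction t)
  case (Output b)
  then show ?case by (intro exI[of _ "{}"]) auto
next
  case (Query x i t)
  obtain D where D: "finite D" "card D \<le> num_queries f (t (f x i))"
    "\<And>g. \<forall>(x, i)\<in>D. g x i = f x i \<Longrightarrow> accepts g (t (f x i)) = accepts f (t (f x i))"
    using Query.IH[of "t (f x i)"] by blast
  have "card (insert (x, i) D) \<le> Suc (card D)"
    using D(1) by (simp add: card_insert_if)
  then have "card (insert (x, i) D) \<le> num_queries f (Query x i t)"
    unfolding num_queries.simps by (rule order_trans) (simp only: Suc_le_mono D(2))
  moreover have "accepts g (Query x i t) = accepts f (Query x i t)"
    if "\<forall>(x, i)\<in>insert (x, i) D. g x i = f x i" for g
    using that D(3)[of g] by simp
  ultimately show ?case
    using D(1) by (intro exI[of _ "insert (x, i) D"] conjI allI impI finite.insertI)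
qed

text \<open>Keeping the variable tuple of an unseen constraint and changing only its negations leaves the
  position of every constraint in every incidence list unchanged.\<close>

lemma satisfiable_completion:
  fixes Q :: "('k::finite) predicate"
  assumes I: "I \<in> csp_instances d n" and inj: "inj_on fst (constraints I)"
    and sat: "satisfiable Q S" and x0: "Q x0"
  obtains J h where "J \<in> csp_instances d n" "satisfiable Q (constraints J)"
    "\<And>x i. oracle_of J x i = map_option h (oracle_of I x i)" "\<And>c. c \<in> S \<Longrightarrow> h c = c"
proof -
  obtain \<sigma> where \<sigma>: "\<And>c. c \<in> S \<Longrightarrow> satisfies Q \<sigma> c"
    using sat unfolding satisfiable_def by auto
  \<comment> \<open>For \<open>c\<close> outside \<open>S\<close> the negations are chosen so that
    \<open>\<sigma>\<close> feeds exactly the input \<open>x0\<close> to the predicate.\<close>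
  define h where "h c = (if c \<in> S then c else (fst c, \<lambda>i. \<sigma> (fst c i) \<noteq> x0 i))" for c
  have fst_h: "fst (h c) = fst c" for c by (simp add: h_def)
  have vars_h: "constr_vars (h c) = constr_vars c" for c by (simp add: constr_vars_def fst_h)
  \<comment> \<open>Tuples are kept and distinct constraints have distinct tuples, so no two
    constraints get merged and the incidence lists stay distinct.\<close>
  have inj_h: "inj_on h (constraints I)"
    using inj by (metis fst_h inj_onD inj_onI)
  define J :: "'k csp"
    where "J = \<lparr>constraints = h ` constraints I, incidence = (\<lambda>x. map h (incidence I x))\<rparr>"
  have containing: "{c \<in> constraints J. x \<in> constr_vars c} =
      h ` {c \<in> constraints I. x \<in> constr_vars c}" for x
    by (auto simp: J_def vars_h)
  have "J \<in> csp_instances d n"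
    unfolding csp_instances_def
  proof (intro CollectI conjI allI impI ballI)
    fix c assume "c \<in> constraints J"
    then show "constr_vars c \<subseteq> {..<n}"
      using I unfolding csp_instances_def by (auto simp: J_def vars_h subset_iff simp del: split_paired_All)
  next
    fix x
    have *: "set (incidence I x) = {c \<in> constraints I. x \<in> constr_vars c}" "distinct (incidence I x)"
      using I by (auto simp: csp_instances_def)
    have "inj_on h (set (incidence I x))"
      by (rule inj_on_subset[OF inj_h]) (auto simp: *)
    then show "distinct (incidence J x)" using * by (simp add: J_def distinct_map)
    show "set (incidence J x) = {c \<in> constraints J. x \<in> constr_vars c}"
      unfolding containing by (simp add: J_def *)
  next
    fix x assume "x < n"
    then have "card {c \<in> constraints I. x \<in> constr_vars c} \<le> d"
      using I by (auto simp: csp_instances_def)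
    moreover have "finite {c \<in> constraints I. x \<in> constr_vars c}"
    proof -
      have "{c \<in> constraints I. x \<in> constr_vars c} = set (incidence I x)"
        using I by (auto simp: csp_instances_def)
      then show ?thesis by simp
    qed
    ultimately show "card {c \<in> constraints J. x \<in> constr_vars c} \<le> d"
      unfolding containing using card_image_le order_trans by blast
  qed
  moreover have "satisfies Q \<sigma> (h c)" for c
  proof (cases "c \<in> S")
    case False
    have "(\<lambda>i. \<sigma> (fst c i) \<noteq> (\<sigma> (fst c i) \<noteq> x0 i)) = x0" by auto
    with False x0 show ?thesis by (simp add: satisfies_def h_def)
  qed (simp add: h_def \<sigma>)
  then have "satisfiable Q (constraints J)"
    unfolding satisfiable_def J_def by (intro exI[of _ \<sigma>]) (simp add: ball_simps)
  moreover have "oracle_of J x i = map_option h (oracle_of I x i)" for x i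
    by (auto simp: oracle_of_def J_def)
  moreover have "h c = c" if "c \<in> S" for c using that by (simp add: h_def)
  ultimately show ?thesis by (rule that)
qed

text \<open>Some tree in the support of \<open>A\<close> rejects \<open>I\<close>. With at most
  \<open>q\<close> queries it sees at most \<open>q\<close> constraints, which are satisfiable
  together. Completing them yields a satisfiable instance with the same answers along the path; the
  tree rejects it too, and does so with positive probability, against one-sidedness.\<close>

lemma one_sided_tester_many_queries:
  fixes Q :: "('k::finite) predicate"
  assumes I: "I \<in> csp_instances d n" and inj: "inj_on fst (constraints I)"
    and far: "far_from_satisfiable Q \<delta> d n I"
    and sat: "\<And>S. S \<subseteq> constraints I \<Longrightarrow> finite S \<Longrightarrow> card S \<le> q \<Longrightarrow> satisfiable Q S"
    and Q: "Q x0" and A: "one_sided_tester Q \<delta> d n A"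
  shows "\<exists>t\<in>set_pmf A. q < num_queries (oracle_of I) t"
proof -
  have "reject_prob A I \<ge> 2/3"
    using A I far unfolding one_sided_tester_def tester_def by auto
  then have "measure_pmf.prob A {t. \<not> accepts (oracle_of I) t} \<noteq> 0"
    unfolding reject_prob_def by linarith
  then obtain t where t: "t \<in> set_pmf A" "\<not> accepts (oracle_of I) t"
    by (metis (mono_tags, lifting) disjoint_iff measure_pmf_zero_iff mem_Collect_eq)
  have "q < num_queries (oracle_of I) t"
  proof (rule ccontr)
    assume few: "\<not> q < num_queries (oracle_of I) t"
    obtain D where D: "finite D" "card D \<le> num_queries (oracle_of I) t"
      "\<And>g. \<forall>(x, i)\<in>D. g x i = oracle_of I x i \<Longrightarrow> accepts g t = accepts (oracle_of I) t"
      using decision_tree_depends_on[of "oracle_of I" t] by blast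
    \<comment> \<open>Only answers \<open>Some c\<close> reveal a constraint; an answer
      \<open>None\<close> is preserved by \<open>map_option h\<close> in any case.\<close>
    define S where "S = {c. Some c \<in> (\<lambda>(x, i). oracle_of I x i) ` D}"
    have S_sub: "Some ` S \<subseteq> (\<lambda>(x, i). oracle_of I x i) ` D" by (auto simp: S_def)
    have finS: "finite S"
      using finite_subset[OF S_sub] D(1) by (simp add: finite_image_iff)
    have "card S = card (Some ` S)" by (simp add: card_image)
    also have "\<dots> \<le> card D"
      by (meson D(1) S_sub card_image_le card_mono finite_imageI le_trans)
    finally have cardS: "card S \<le> q" using D few by linarith
    have set_inc: "set (incidence I x) \<subseteq> constraints I" for x
      using I by (auto simp: csp_instances_def)
    have "S \<subseteq> constraints I"
      by (auto simp: S_def oracle_of_def split: if_splits)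
        (metis Suc_le_lessD diff_Suc_less nth_mem set_inc subsetD order_less_le_trans)
    then have sat_S: "satisfiable Q S" using finS cardS by (rule sat)
    obtain J h
      where J: "J \<in> csp_instances d n" "satisfiable Q (constraints J)"
        "\<And>x i. oracle_of J x i = map_option h (oracle_of I x i)" "\<And>c. c \<in> S \<Longrightarrow> h c = c"
      using satisfiable_completion[where S = S, OF I inj sat_S Q] by blast
    have "oracle_of J x i = oracle_of I x i" if "(x, i) \<in> D" for x i
    proof (cases "oracle_of I x i")
      case (Some c)
      then have "c \<in> S" using that by (force simp: S_def)
      then show ?thesis using Some J by simp
    qed (simp add: J)
    then have "\<not> accepts (oracle_of J) t" using D(3)[of "oracle_of J"] t by auto
    moreover have "accept_prob A J = 1" using A J unfolding one_sided_tester_def by auto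
    then have "AE t in measure_pmf A. accepts (oracle_of J) t"
      unfolding accept_prob_def by (subst (asm) measure_pmf.prob_eq_1) auto
    ultimately show False using t(1) by (auto simp: AE_measure_pmf_iff)
  qed
  with t show ?thesis by blast
qed

subsection \<open>Peeling\<close>

text \<open>Two prescribed inputs containing a ones can be completed to any weight from a to k - 2 +
  a. For k \<ge> 3, one of two complementary accepted weights lies in this range.\<close>

lemma symmetric_predicate_extends:
  fixes P :: "('k::finite) predicate"
  assumes k: "CARD('k) \<ge> 3" and sym: "symmetric_predicate P"
    and ne: "card {x. P x} > 0" and nEQU: "P \<noteq> EQU" and F: "card F \<le> 2"
  shows "\<exists>x. P x \<and> (\<forall>i\<in>F. x i = y i)"
proof -
  let ?k = "CARD('k)"
  have Pw: "P x = P z" if "hamming_weight x = hamming_weight z" for x z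
    using sym that unfolding symmetric_predicate_def by blast
  have Pc: "P x = P (\<lambda>i. \<not> x i)" for x
    using sym unfolding symmetric_predicate_def by blast
  have hw_compl: "hamming_weight (\<lambda>i. \<not> x i) = ?k - hamming_weight x" for x :: "'k \<Rightarrow> bool"
  proof -
    have "{i. \<not> x i} = - {i. x i}" by auto
    then show ?thesis by (simp add: hamming_weight_def Compl_eq_Diff_UNIV card_Diff_subset)
  qed
  have hw_le: "hamming_weight x \<le> ?k" for x :: "'k \<Rightarrow> bool"
    unfolding hamming_weight_def by (rule card_mono) auto
  have hw_0: "hamming_weight x = 0 \<longleftrightarrow> x = (\<lambda>_. False)" for x :: "'k \<Rightarrow> bool"
    by (auto simp: hamming_weight_def)
  have hw_k: "hamming_weight x = ?k \<longleftrightarrow> x = (\<lambda>_. True)" for x :: "'k \<Rightarrow> bool"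
  proof
    assume "hamming_weight x = ?k"
    then have "{i. x i} = UNIV" unfolding hamming_weight_def by (simp add: card_eq_UNIV_imp_eq_UNIV)
    then show "x = (\<lambda>_. True)" by auto
  qed (simp add: hamming_weight_def)
  have EQU_iff: "EQU x \<longleftrightarrow> x = (\<lambda>_. False) \<or> x = (\<lambda>_. True)" for x :: "'k \<Rightarrow> bool"
    unfolding EQU_def fun_eq_iff by (metis (full_types))
  \<comment> \<open>If only the weights 0 and k were accepted, nonemptiness and closure under
    complement would make both constant inputs accepted, and so \<open>P = EQU\<close>.\<close>
  obtain z where z: "P z" "0 < hamming_weight z" "hamming_weight z < ?k"
  proof (rule ccontr)
    assume "\<not> thesis"
    with that have none: "\<And>x. P x \<Longrightarrow> hamming_weight x = 0 \<or> hamming_weight x = ?k"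
      by (metis hw_le neq0_conv order_le_less)
    then have sub: "P x \<Longrightarrow> EQU x" for x by (metis EQU_iff hw_0 hw_k)
    obtain x where "P x" using ne by (metis Collect_empty_eq card.empty less_irrefl)
    with sub Pc[of x] have "P (\<lambda>_. False) \<and> P (\<lambda>_. True)"
      using EQU_iff[of x] Pc[of "\<lambda>_. True"] Pc[of "\<lambda>_. False"] by auto
    with sub have "P = EQU" by (auto simp: fun_eq_iff[of P] EQU_iff)
    with nEQU show False by simp
  qed
  define w where "w = hamming_weight z"
  have w: "0 < w" "w < ?k" using z by (simp_all add: w_def)
  have P_weight: "P x" if "hamming_weight x \<in> {w, ?k - w}" for x
    using that z(1) Pw[of x z] Pw[of x "\<lambda>i. \<not> z i"] Pc[of z] hw_compl[of z] by (auto simp: w_def)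
  \<comment> \<open>Padding \<open>F\<close> to exactly two indices leaves only the number of ones
    among them to be considered.\<close>
  obtain G where G: "F \<subseteq> G" "card G = 2"
    using exists_subset_between[of F 2 UNIV] F k by auto
  define Y where "Y = {i \<in> G. y i}"
  have Y: "card Y \<le> 2" using G by (metis (no_types, lifting) Y_def card_mono finite mem_Collect_eq subsetI)
  \<comment> \<open>With no ones the only excluded intermediate weight is k - 1, with two ones it is
    1. Both \<open>w\<close> and \<open>?k - w\<close> being excluded would force k = 2.\<close>
  have "\<exists>v\<in>{w, ?k - w}. card Y \<le> v \<and> v \<le> ?k - 2 + card Y"
  proof -
    consider "card Y = 0" | "card Y = 1" | "card Y = 2" using Y by linarith
    then show ?thesis using w k by cases auto
  qed
  then obtain v where v: "v \<in> {w, ?k - w}" "card Y \<le> v" "v \<le> ?k - 2 + card Y" by blast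
  have "card (- G) = ?k - 2" using G by (simp add: Compl_eq_Diff_UNIV card_Diff_subset)
  then have "v - card Y \<le> card (- G)" using v by linarith
  then obtain Z where Z: "Z \<subseteq> - G" "card Z = v - card Y"
    by (metis obtain_subset_with_card_n)
  define x where "x i = (i \<in> Y \<or> i \<in> Z)" for i
  have "{i. x i} = Y \<union> Z" by (auto simp: x_def)
  moreover have "card (Y \<union> Z) = card Y + card Z"
    by (rule card_Un_disjoint) (use Z in \<open>auto simp: Y_def\<close>)
  ultimately have "hamming_weight x = v" using Z v by (simp add: hamming_weight_def)
  then have "P x" using v P_weight by blast
  moreover have "x i = y i" if "i \<in> F" for i
    using that G Z by (auto simp: x_def Y_def)
  ultimately show ?thesis by blast
qed

text \<open>Induction removes a constraint with at most two inputs shared with the rest. A solution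
  of the rest prescribes only these inputs, and they extend to an input accepted by
  \<open>P\<close>. The negations are arbitrary throughout.\<close>

lemma satisfiable_by_peeling:
  fixes P :: "('k::finite) predicate" and S :: "'k constr set"
  assumes k: "CARD('k) \<ge> 3" and sym: "symmetric_predicate P"
    and ne: "card {x. P x} > 0" and nEQU: "P \<noteq> EQU" and fin: "finite S"
    and inj: "\<And>c. c \<in> S \<Longrightarrow> inj (fst c)"
    and peel: "\<And>T. T \<subseteq> S \<Longrightarrow> T \<noteq> {} \<Longrightarrow>
      \<exists>c\<in>T. card (fst c -` (\<Union>c'\<in>T - {c}. constr_vars c')) \<le> 2"
  shows "satisfiable P S"
  using fin inj peel
proof (induction S rule: finite_psubset_induct)
  case (psubset S)
  show ?case
  proof (cases "S = {}")
    case True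
    then show ?thesis by (simp add: satisfiable_def)
  next
    case False
    define F where "F c = fst c -` (\<Union>c'\<in>S - {c}. constr_vars c')" for c
    from psubset.prems(2)[of S] False obtain c where c: "c \<in> S" "card (F c) \<le> 2"
      unfolding F_def by blast
    have "satisfiable P (S - {c})"
    proof (rule psubset.IH)
      show "S - {c} \<subset> S" using c by auto
      show "inj (fst c')" if "c' \<in> S - {c}" for c' using psubset.prems(1) that by blast
      show "\<exists>c\<in>T. card (fst c -` (\<Union>c'\<in>T - {c}. constr_vars c')) \<le> 2"
        if "T \<subseteq> S - {c}" "T \<noteq> {}" for T
        using that by (intro psubset.prems(2)) auto
    qed
    then obtain \<sigma> where \<sigma>: "\<And>c'. c' \<in> S - {c} \<Longrightarrow> satisfies P \<sigma> c'"
      unfolding satisfiable_def by auto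
    obtain x where x: "P x" "\<And>i. i \<in> F c \<Longrightarrow> x i = (\<sigma> (fst c i) \<noteq> snd c i)"
      using symmetric_predicate_extends
        [OF k sym ne nEQU c(2), where y = "\<lambda>i. \<sigma> (fst c i) \<noteq> snd c i"] by blast
    have injc: "inj (fst c)" using c psubset.prems(1) by blast
    \<comment> \<open>\<open>\<tau>\<close> overwrites every variable of \<open>c\<close>;
      injectivity of the tuple justifies \<open>inv\<close>. On variables shared with other
      constraints the new value equals the old one, because \<open>x\<close> was chosen to agree
      with \<open>\<sigma>\<close> there.\<close>
    define \<tau> where
      "\<tau> v = (if v \<in> range (fst c) then x (inv (fst c) v) \<noteq> snd c (inv (fst c) v) else \<sigma> v)" for v
    have "satisfies P \<tau> c"
    proof -
      have "(\<lambda>i. \<tau> (fst c i) \<noteq> snd c i) = x" using injc by (auto simp: \<tau>_def)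
      then show ?thesis using x by (simp add: satisfies_def)
    qed
    moreover have "satisfies P \<tau> c'" if c': "c' \<in> S - {c}" for c'
    proof -
      have "\<tau> (fst c' i) = \<sigma> (fst c' i)" for i
      proof (cases "fst c' i \<in> range (fst c)")
        case True
        then obtain j where j: "fst c' i = fst c j" by auto
        then have "fst c j \<in> constr_vars c'" unfolding constr_vars_def by (metis rangeI)
        then have "j \<in> F c" using c' unfolding F_def by blast
        then show ?thesis using j injc x(2)[of j] by (auto simp: \<tau>_def)
      qed (simp add: \<tau>_def)
      then show ?thesis using \<sigma>[OF c'] by (simp add: satisfies_def)
    qed
    ultimately have "\<forall>c'\<in>S. satisfies P \<tau> c'" by blast
    then show ?thesis unfolding satisfiable_def by blast
  qed
qed

text \<open>Double counting: each constraint gives weight 1 to its shared variables and weight 2 to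
  its private ones, so every covered variable receives at least 2 in total. If all constraints had
  three or more shared variables, each would give at most 2k - 3, contradicting
  \<open>spread\<close>.\<close>

lemma exists_constraint_with_two_shared_variables:
  fixes T :: "('k::finite) constr set"
  assumes fin: "finite T" and inj: "\<And>c. c \<in> T \<Longrightarrow> inj (fst c)"
    and spread: "(2 * CARD('k) - 3) * card T < 2 * card (\<Union>c\<in>T. constr_vars c)"
  shows "\<exists>c\<in>T. card (fst c -` (\<Union>c'\<in>T - {c}. constr_vars c')) \<le> 2"
proof (rule ccontr)
  define W where "W c = (\<Union>c'\<in>T - {c}. constr_vars c')" for c
  assume "\<not> ?thesis"
  then have shared: "3 \<le> card (fst c -` W c)" if "c \<in> T" for c
    using that unfolding W_def by (metis not_less_eq_eq numeral_3_eq_3 numeral_2_eq_2)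
  define V where "V = (\<Union>c\<in>T. constr_vars c)"
  have finV: "finite V" using fin by (auto simp: V_def constr_vars_def)
  define wt :: "'k constr \<Rightarrow> nat \<Rightarrow> nat"
    where "wt c v = (if v \<in> constr_vars c then if v \<in> W c then 1 else 2 else 0)" for c v
  have "2 \<le> (\<Sum>c\<in>T. wt c v)" if v: "v \<in> V" for v
  proof -
    obtain c where c: "c \<in> T" "v \<in> constr_vars c" using v by (auto simp: V_def)
    show ?thesis
    proof (cases "v \<in> W c")
      case False
      then have "2 \<le> wt c v" using c by (simp add: wt_def)
      also have "\<dots> \<le> (\<Sum>c\<in>T. wt c v)" using c fin by (intro member_le_sum) auto
      finally show ?thesis .
    next
      case True
      then obtain c' where c': "c' \<in> T" "c' \<noteq> c" "v \<in> constr_vars c'" by (auto simp: W_def)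
      have "2 \<le> (\<Sum>c\<in>{c, c'}. wt c v)" using c c' by (auto simp: wt_def)
      also have "\<dots> \<le> (\<Sum>c\<in>T. wt c v)" using c c' fin by (intro sum_mono2) auto
      finally show ?thesis .
    qed
  qed
  then have "(\<Sum>v\<in>V. 2) \<le> (\<Sum>v\<in>V. \<Sum>c\<in>T. wt c v)" by (rule sum_mono)
  then have "2 * card V \<le> (\<Sum>c\<in>T. \<Sum>v\<in>V. wt c v)" by (subst (asm) sum.swap) simp
  also have "\<dots> \<le> (\<Sum>c\<in>T. 2 * CARD('k) - 3)"
  proof (rule sum_mono)
    fix c assume c: "c \<in> T"
    have "(\<Sum>v\<in>V. wt c v) = (\<Sum>v\<in>constr_vars c. if v \<in> W c then 1 else 2)"
      using c finV by (intro sum.mono_neutral_cong_right) (auto simp: wt_def V_def)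
    also have "\<dots> = (\<Sum>i\<in>UNIV. if fst c i \<in> W c then 1 else 2)"
      unfolding constr_vars_def using inj[OF c] by (subst sum.reindex) auto
    also have "\<dots> = card (fst c -` W c) + 2 * card (- (fst c -` W c))"
      by (subst sum.If_cases) (auto simp: vimage_def Compl_eq)
    also have "\<dots> \<le> 2 * CARD('k) - 3"
    proof -
      have "card (fst c -` W c) \<le> CARD('k)" by (intro card_mono) auto
      then show ?thesis using shared[OF c] by (simp add: Compl_eq_Diff_UNIV card_Diff_subset)
    qed
    finally show "(\<Sum>v\<in>V. wt c v) \<le> 2 * CARD('k) - 3" .
  qed
  finally show False using spread by (simp add: V_def mult.commute)
qed

subsection \<open>Random partitions\<close>

text \<open>By symmetry under swaps, all points outside \<open>A\<close> are equally likely to be sent into \<open>U\<close>, so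
  averaging over them bounds the loss incurred by adding one point to \<open>A\<close>.\<close>

lemma card_permutations_into:
  assumes N: "finite N" and A: "A \<subseteq> N" and U: "U \<subseteq> N"
  shows "card {\<pi>. \<pi> permutes N \<and> \<pi> ` A \<subseteq> U} * card N ^ card A \<le> card U ^ card A * fact (card N)"
proof -
  have "finite A" using A N by (rule finite_subset)
  define X where "X A = {\<pi>. \<pi> permutes N \<and> \<pi> ` A \<subseteq> U}" for A
  have finX: "finite (X A)" for A
    using finite_permutations[OF N] by (rule finite_subset[rotated]) (auto simp: X_def)
  \<comment> \<open>Multiplied out, this bounds the probability that a random permutation sends
    \<open>A\<close> into \<open>U\<close> by its value for independent uniform images.\<close>
  have "card (X A) * card N ^ card A \<le> card U ^ card A * fact (card N)"
    using \<open>finite A\<close> A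
  proof (induction A rule: finite_induct)
    case empty
    then show ?case using card_permutations[OF refl N] by (simp add: X_def)
  next
    case (insert a A)
    have finU: "finite U" using U N by (rule finite_subset)
    have UN: "card U \<le> card N" using U N by (intro card_mono)
    have aN: "a \<in> N" "A \<subseteq> N" using insert by auto
    have AN: "card A < card N"
      using insert N by (intro psubset_card_mono) auto
    have swap: "card (X (insert b A)) = card (X (insert a A))" if b: "b \<in> N - A" for b
    proof (rule bij_betw_same_card[of "\<lambda>\<pi>. \<pi> \<circ> Transposition.transpose a b"],
        rule bij_betw_byWitness[where f' = "\<lambda>\<pi>. \<pi> \<circ> Transposition.transpose a b"])
      have fixA: "Transposition.transpose a b x = x" if "x \<in> A" for x
        using that b insert.hyps by (metis DiffD2 Transposition.transpose_apply_other)
      have tr: "Transposition.transpose a b permutes N" using aN b by (intro permutes_swap_id) auto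
      show "(\<lambda>\<pi>. \<pi> \<circ> Transposition.transpose a b) ` X (insert b A) \<subseteq> X (insert a A)"
        using permutes_compose[OF tr] fixA by (auto simp: X_def image_subset_iff)
      show "(\<lambda>\<pi>. \<pi> \<circ> Transposition.transpose a b) ` X (insert a A) \<subseteq> X (insert b A)"
        using permutes_compose[OF tr] fixA by (auto simp: X_def image_subset_iff)
    qed (auto simp: comp_assoc)
    \<comment> \<open>The pairs of a point \<open>b\<close> outside \<open>A\<close> and a
      permutation in \<open>X A\<close> sending \<open>b\<close> into \<open>U\<close> are counted
      in two ways.\<close>
    have "(card N - card A) * card (X (insert a A)) = (\<Sum>b\<in>N - A. card (X (insert b A)))"
      using swap aN insert.hyps(1) by (simp add: card_Diff_subset)
    also have "\<dots> = (\<Sum>b\<in>N - A. \<Sum>\<pi>\<in>X A. if \<pi> b \<in> U then 1 else 0)"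
    proof (rule sum.cong[OF refl])
      fix b
      have "X (insert b A) = {\<pi> \<in> X A. \<pi> b \<in> U}" by (auto simp: X_def)
      then show "card (X (insert b A)) = (\<Sum>\<pi>\<in>X A. if \<pi> b \<in> U then 1 else 0)"
        using finX by (simp only: card_eq_sum sum.inter_filter)
    qed
    also have "\<dots> = (\<Sum>\<pi>\<in>X A. card {b \<in> N - A. \<pi> b \<in> U})"
      using N by (subst sum.swap) (simp only: card_eq_sum sum.inter_filter finite_Diff)
    also have "\<dots> \<le> (\<Sum>\<pi>\<in>X A. card U - card A)"
    proof (rule sum_mono)
      fix \<pi> assume \<pi>: "\<pi> \<in> X A"
      then have "inj \<pi>" by (auto simp: X_def permutes_inj)
      let ?B = "{b \<in> N - A. \<pi> b \<in> U}"
      \<comment> \<open>An injective \<open>\<pi>\<close> already uses \<open>card A\<close> points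
        of \<open>U\<close> for \<open>A\<close>, so at most \<open>card U - card A\<close> remain
        for the other points.\<close>
      have "card ?B + card A = card (?B \<union> A)"
        using N insert.hyps by (subst card_Un_disjoint) auto
      also have "\<dots> = card (\<pi> ` (?B \<union> A))"
        using card_image[OF inj_on_subset[OF \<open>inj \<pi>\<close> subset_UNIV]] by simp
      also have "\<dots> \<le> card U"
        using \<pi> finU by (intro card_mono) (auto simp: X_def)
      finally show "card ?B \<le> card U - card A" by simp
    qed
    finally have avg: "(card N - card A) * card (X (insert a A)) \<le> card (X A) * (card U - card A)"
      by simp
    \<comment> \<open>Cross-multiplied form of (u - a) / (N - a) \<le> u / N for u \<le> N; under
      truncated subtraction the left side is 0 when u < a.\<close>
    have "(card U - card A) * card N \<le> (card N - card A) * card U"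
    proof -
      have "card N * card U - card A * card N \<le> card N * card U - card A * card U"
        using UN by (simp add: diff_le_mono2)
      then show ?thesis by (simp add: diff_mult_distrib mult.commute[of "card U" "card N"])
    qed
    then have "card (X A) * (card U - card A) * card N \<le> card (X A) * ((card N - card A) * card U)"
      unfolding mult.assoc by (rule mult_left_mono) simp
    with mult_right_mono[OF avg, of "card N"]
    have "(card N - card A) * card (X (insert a A)) * card N \<le> card (X A) * ((card N - card A) * card U)"
      by linarith
    then have "(card N - card A) * (card (X (insert a A)) * card N) \<le>
        (card N - card A) * (card (X A) * card U)"
      by (simp only: mult_ac)
    then have step: "card (X (insert a A)) * card N \<le> card (X A) * card U"
      using AN by simp
    have "card (X (insert a A)) * card N ^ card (insert a A) =
        (card (X (insert a A)) * card N) * card N ^ card A"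
      using insert.hyps by (simp add: mult_ac)
    also have "\<dots> \<le> (card (X A) * card U) * card N ^ card A"
      using step by (rule mult_right_mono) simp
    also have "\<dots> = card U * (card (X A) * card N ^ card A)" by (simp add: mult_ac)
    also have "\<dots> \<le> card U * (card U ^ card A * fact (card N))"
      using insert.IH aN by (intro mult_left_mono) auto
    finally show ?case using insert.hyps by (simp add: mult_ac)
  qed
  then show ?thesis by (simp add: X_def)
qed

text \<open>The bound (e n / s)^s on the binomial coefficient, multiplied out so that s = 0 is
  covered. It holds because s^s / s! is one term of the series of exp s, and (n choose s) s! \<le>
  n^s.\<close>

lemma binomial_mult_power_le: "real (n choose s) * real s ^ s \<le> (exp 1 * real n) ^ s"
proof -
  have "real s ^ s / fact s \<le> exp (real s)"
    using sums_unique[OF exp_converges[of "real s"]] summable_exp_generic[of "real s"]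
      sum_le_suminf[of "\<lambda>n. real s ^ n /\<^sub>R fact n" "{s}"]
    by (auto simp: divide_simps)
  then have "real s ^ s \<le> exp (real s) * fact s" by (simp add: field_simps)
  then have "real (n choose s) * real s ^ s \<le> real (n choose s) * (exp (real s) * fact s)"
    by (rule mult_left_mono) simp
  also have "\<dots> = exp (real s) * real ((n choose s) * fact s)" by simp
  also have "\<dots> \<le> exp (real s) * real (n ^ s)"
    using binomial_fact_pow[of n s] by (intro mult_left_mono) (simp_all only: of_nat_le_iff exp_ge_zero)
  finally show ?thesis by (simp add: power_mult_distrib exp_of_nat_mult flip: exp_of_nat_mult)
qed

text \<open>A slot (i, j) stands for block j of partition i, the image under \<open>w i\<close> of
  the j-th interval of length k. Blocks of one partition are disjoint, so each partition meets a
  condition on k points per slot; the d permutations vary independently, and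
  \<open>fact n ^ d\<close> counts all families.\<close>

lemma card_matchings_into:
  assumes n: "n > 0" and S: "S \<subseteq> {..<d} \<times> {..<n div k}" and U: "U \<subseteq> {..<n}"
  shows "real (card {w \<in> {..<d} \<rightarrow>\<^sub>E {\<pi>. \<pi> permutes {..<n}}.
            \<forall>(i, j)\<in>S. w i ` {k * j..<k * j + k} \<subseteq> U})
         \<le> (real (card U) / real n) ^ (k * card S) * fact n ^ d"
proof -
  define T where "T i = {j. (i, j) \<in> S}" for i
  define A where "A i = (\<Union>j\<in>T i. {k * j..<k * j + k})" for i
  define X where "X i = {\<pi>. \<pi> permutes {..<n} \<and> \<pi> ` A i \<subseteq> U}" for i
  have T_sub: "T i \<subseteq> {..<n div k}" for i using S by (auto simp: T_def)
  have fin_T: "finite (T i)" for i using T_sub by (rule finite_subset) simp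
  have in_block: "x div k = j" if "x \<in> {k * j..<k * j + k}" for x j
    using that by (intro div_nat_eqI) auto
  have card_A: "card (A i) = k * card (T i)" for i
  proof -
    have "card (A i) = (\<Sum>j\<in>T i. card {k * j..<k * j + k})"
      unfolding A_def
    proof (rule card_UN_disjoint[OF fin_T])
      show "\<forall>j\<in>T i. \<forall>j'\<in>T i. j \<noteq> j' \<longrightarrow> {k * j..<k * j + k} \<inter> {k * j'..<k * j' + k} = {}"
        using in_block by blast
    qed simp
    then show ?thesis by simp
  qed
  have A_sub: "A i \<subseteq> {..<n}" for i
  proof
    fix x assume "x \<in> A i"
    then obtain j where j: "j \<in> T i" "x < k * j + k" by (auto simp: A_def)
    then have "k * Suc j \<le> k * (n div k)" using T_sub[of i] by (intro mult_le_mono2) auto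
    also have "\<dots> \<le> n" by simp
    finally show "x \<in> {..<n}" using j by simp
  qed
  have "{w \<in> {..<d} \<rightarrow>\<^sub>E {\<pi>. \<pi> permutes {..<n}}. \<forall>(i, j)\<in>S. w i ` {k * j..<k * j + k} \<subseteq> U}
      = (\<Pi>\<^sub>E i\<in>{..<d}. X i)" (is "?E = _")
  proof (intro equalityI subsetI)
    fix w assume "w \<in> ?E"
    then have w: "w \<in> {..<d} \<rightarrow>\<^sub>E {\<pi>. \<pi> permutes {..<n}}"
      and all: "\<forall>(i, j)\<in>S. w i ` {k * j..<k * j + k} \<subseteq> U" by simp_all
    have into: "w i ` {k * j..<k * j + k} \<subseteq> U" if "(i, j) \<in> S" for i j
      using bspec[OF all that] by simp
    have "w i ` A i \<subseteq> U" for i unfolding A_def T_def image_UN using into by blast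
    then show "w \<in> (\<Pi>\<^sub>E i\<in>{..<d}. X i)"
      using w by (simp add: PiE_iff X_def)
  next
    fix w assume w: "w \<in> (\<Pi>\<^sub>E i\<in>{..<d}. X i)"
    have "w i ` {k * j..<k * j + k} \<subseteq> U" if "(i, j) \<in> S" for i j
    proof -
      have "i < d" using that S by auto
      then have "w i ` A i \<subseteq> U" using w by (auto simp: PiE_iff X_def)
      moreover have "{k * j..<k * j + k} \<subseteq> A i" using that by (auto simp: A_def T_def)
      ultimately show ?thesis by blast
    qed
    then show "w \<in> ?E" using w by (auto simp: PiE_iff X_def)
  qed
  then have "real (card ?E) = (\<Prod>i<d. real (card (X i)))"
    by (simp add: card_PiE)
  also have "\<dots> \<le> (\<Prod>i<d. (real (card U) / real n) ^ (k * card (T i)) * fact n)"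
  proof (rule prod_mono, rule conjI)
    fix i
    have "real (card (X i) * n ^ (k * card (T i))) \<le> real (card U ^ (k * card (T i)) * fact n)"
      using card_permutations_into[OF _ A_sub[of i] U] unfolding X_def card_A card_lessThan of_nat_le_iff
      by simp
    then show "real (card (X i)) \<le> (real (card U) / real n) ^ (k * card (T i)) * fact n"
      using n by (simp add: power_divide field_simps)
  qed simp
  also have "\<dots> = (real (card U) / real n) ^ (\<Sum>i<d. k * card (T i)) * fact n ^ d"
    by (simp add: prod.distrib power_sum)
  also have "(\<Sum>i<d. k * card (T i)) = k * card S"
  proof -
    have "S = (SIGMA i:{..<d}. T i)" using S by (auto simp: T_def)
    then have "card S = (\<Sum>i<d. card (T i))" using fin_T by simp
    then show ?thesis by (simp add: sum_distrib_left)
  qed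
  finally show ?thesis .
qed

text \<open>This controls the expected number of choices of s blocks and of a u-set of variables
  containing them. With r = k s / n, the blocks contribute at most (e d / r)^s, the u-set with its
  containment probability e^(k s) r^(k s - u). Since k s - u \<ge> 3 s / 2, a positive power of r
  survives, and \<open>s_le\<close> makes r small enough.\<close>

lemma first_moment_bound:
  fixes k d n s u M :: nat
  assumes k: "k > 0" and d: "d > 0" and n: "n > 0" and s: "s > 0"
    and s_le: "16 * exp 1 ^ (2 * k + 2) * real d ^ 2 * real k * real s \<le> real n"
    and u: "2 * u + 3 * s \<le> 2 * k * s" and M: "real M \<le> real d * real n / real k"
  shows "real (M choose s) * real (n choose u) * (real u / real n) ^ (k * s) \<le> (1 / 4) ^ s"
proof -
  define e :: real where "e = exp 1"
  have e: "1 \<le> e" by (simp add: e_def)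
  define r where "r = real k * real s / real n"
  have r: "0 < r" using k n s by (simp add: r_def)
  have small: "e ^ (2 * k + 2) * real d ^ 2 * r \<le> 1 / 16"
    using s_le n by (simp add: r_def e_def field_simps)
  have "1 * 1 \<le> e ^ (2 * k + 2) * real d ^ 2"
    using d e by (intro mult_mono one_le_power) auto
  then have "1 * r \<le> e ^ (2 * k + 2) * real d ^ 2 * r"
    using r by (intro mult_right_mono) auto
  then have r1: "r \<le> 1" using small by simp
  have uks: "u \<le> k * s" using u by simp

  have bound_M: "real (M choose s) \<le> (e * real d / r) ^ s"
  proof -
    have "real (M choose s) * real s ^ s \<le> (e * real M) ^ s"
      unfolding e_def by (rule binomial_mult_power_le)
    also have "\<dots> \<le> (e * (real d * real n / real k)) ^ s"
      using M e by (intro power_mono mult_left_mono) auto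
    also have "\<dots> = (e * real d / r) ^ s * real s ^ s"
      using s k n by (simp add: r_def mult.assoc flip: power_mult_distrib)
    finally show ?thesis using s by simp
  qed
  \<comment> \<open>Of the \<open>k * s\<close> factors u / n, u of them are spent against the
    binomial coefficient; the others are bounded by \<open>r\<close>.\<close>
  have bound_u: "real (n choose u) * (real u / real n) ^ u \<le> e ^ u"
  proof -
    have "real (n choose u) * real u ^ u \<le> (e * real n) ^ u"
      unfolding e_def by (rule binomial_mult_power_le)
    then show ?thesis using n by (simp add: power_divide power_mult_distrib field_simps)
  qed
  have "real u / real n \<le> r"
    using uks n by (simp add: r_def divide_right_mono flip: of_nat_mult)
  then have "(real u / real n) ^ (k * s - u) \<le> r ^ (k * s - u)"
    by (intro power_mono) auto
  moreover have "e ^ u \<le> e ^ (k * s)"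
    using uks e by (rule power_increasing)
  ultimately have "real (n choose u) * (real u / real n) ^ u * (real u / real n) ^ (k * s - u)
      \<le> e ^ (k * s) * r ^ (k * s - u)"
    using bound_u e by (intro mult_mono) auto
  also have "real (n choose u) * (real u / real n) ^ u * (real u / real n) ^ (k * s - u)
      = real (n choose u) * (real u / real n) ^ (k * s)"
    using uks by (simp add: mult.assoc flip: power_add)
  finally have bound_U: "real (n choose u) * (real u / real n) ^ (k * s)
      \<le> e ^ (k * s) * r ^ (k * s - u)" .

  let ?T = "real (M choose s) * (real (n choose u) * (real u / real n) ^ (k * s))"
  have "?T \<le> (e * real d / r) ^ s * (e ^ (k * s) * r ^ (k * s - u))"
    by (rule mult_mono[OF bound_M bound_U]) (use e r in auto)
  \<comment> \<open>Squaring avoids the half-integral exponent 3 s / 2; \<open>r \<le> 1\<close>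
    then allows \<open>2 * (k * s - u)\<close> to be lowered to \<open>3 * s\<close>.\<close>
  then have "?T ^ 2 \<le> ((e * real d / r) ^ s * (e ^ (k * s) * r ^ (k * s - u))) ^ 2"
    by (intro power_mono) auto
  also have "\<dots> = (e * real d / r) ^ (2 * s) * (e ^ (2 * k * s) * r ^ (2 * (k * s - u)))"
    by (simp add: power_mult_distrib mult_ac flip: power_mult)
  also have "\<dots> \<le> (e * real d / r) ^ (2 * s) * (e ^ (2 * k * s) * r ^ (3 * s))"
    using e r r1 u by (intro mult_left_mono power_decreasing) auto
  also have "\<dots> = ((e * real d / r) ^ 2 * (e ^ (2 * k) * r ^ 3)) ^ s"
    by (simp only: power_mult power_mult_distrib)
  also have "(e * real d / r) ^ 2 * (e ^ (2 * k) * r ^ 3) = e ^ (2 * k + 2) * real d ^ 2 * r"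
    using r by (simp add: power_add field_simps power2_eq_square power3_eq_cube)
  also have "(e ^ (2 * k + 2) * real d ^ 2 * r) ^ s \<le> (1 / 16) ^ s"
    using small e r by (intro power_mono) auto
  also have "(1 / 16) ^ s = ((1 / 4 :: real) ^ s) ^ 2"
    by (simp add: power2_eq_square flip: power_mult_distrib)
  finally have "?T \<le> (1 / 4) ^ s"
    by (rule power2_le_imp_le) simp
  then show ?thesis by (simp add: mult.assoc)
qed

lemma sum_quarter_powers_less_1: "(\<Sum>s=1..L. (1 / 4 :: real) ^ s) < 1"
proof -
  have "(\<Sum>s=1..L. (1 / 4 :: real) ^ s) = (1 - (1 / 4) ^ L) / 3"
  proof (induction L)
    case (Suc L)
    have "(\<Sum>s=1..Suc L. (1 / 4 :: real) ^ s) = (\<Sum>s=1..L. (1 / 4) ^ s) + (1 / 4) ^ Suc L"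
      by simp
    then show ?case unfolding Suc.IH by (simp add: field_simps)
  qed simp
  also have "\<dots> < 1" by (simp add: field_simps add_pos_pos)
  finally show ?thesis .
qed

text \<open>Union bound over the size s, the set of slots and the set of variables: bad families
  make up at most a fraction sum of 4^(-s) < 1. The constant \<open>c\<close> turns the bound on
  \<open>card S\<close> into the smallness hypothesis of \<open>first_moment_bound\<close>.\<close>

lemma exists_sparse_matchings:
  fixes k d n :: nat and c :: real
  assumes k: "k \<ge> 3" and d: "d > 0" and n: "n > 0"
    and c: "c = 1 / (16 * exp 1 ^ (2 * k + 2) * real d ^ 2 * real k)"
  shows "\<exists>w. (\<forall>i<d. w i permutes {..<n}) \<and>
    (\<forall>S. S \<subseteq> {..<d} \<times> {..<n div k} \<longrightarrow> S \<noteq> {} \<longrightarrow> real (card S) \<le> c * real n \<longrightarrow>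
       (2 * k - 3) * card S < 2 * card (\<Union>(i, j)\<in>S. w i ` {k * j..<k * j + k}))"
proof -
  define \<Omega> where "\<Omega> = {..<d} \<rightarrow>\<^sub>E {\<pi>. \<pi> permutes {..<n}}"
  have fin\<Omega>: "finite \<Omega>" unfolding \<Omega>_def by (intro finite_PiE) (auto intro: finite_permutations)
  have card\<Omega>: "card \<Omega> = fact n ^ d"
    using card_permutations[of "{..<n}" n] by (simp add: \<Omega>_def card_PiE)
  define slots where "slots = {..<d} \<times> {..<n div k}"
  have fin_slots: "finite slots" by (simp add: slots_def)
  define E where "E S U = {w \<in> \<Omega>. \<forall>(i, j)\<in>S. w i ` {k * j..<k * j + k} \<subseteq> U}" for S U
  define L where "L = nat \<lfloor>c * real n\<rfloor>"
  \<comment> \<open>The largest union size that violates the claimed strict inequality: (k - 3/2) s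
    rounded down.\<close>
  define u where "u s = ((2 * k - 3) * s) div 2" for s
  define SS where "SS s = {S. S \<subseteq> slots \<and> card S = s}" for s
  define UU where "UU s = {U. U \<subseteq> {..<n} \<and> card U = u s}" for s
  have c_pos: "0 < c" using k d by (simp add: c)
  have in_L: "16 * exp 1 ^ (2 * k + 2) * real d ^ 2 * real k * real s \<le> real n" "s \<le> L"
    if "real s \<le> c * real n" for s
  proof -
    show "16 * exp 1 ^ (2 * k + 2) * real d ^ 2 * real k * real s \<le> real n"
      using that k d by (simp add: c field_simps)
    show "s \<le> L" using that by (simp add: L_def le_nat_floor)
  qed
  have le_L: "real s \<le> c * real n" if "s \<le> L" for s
    using that c_pos unfolding L_def by (metis le_nat_iff le_floor_iff of_int_of_nat_eq of_nat_0_le_iff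
        floor_le_iff zero_le_floor mult_nonneg_nonneg less_imp_le)
  have fin_SS: "finite (SS s)" for s
    using fin_slots by (auto simp: SS_def)
  have fin_UU: "finite (UU s)" for s
    by (auto simp: UU_def)
  define Bad where "Bad = (\<Union>s\<in>{1..L}. \<Union>S\<in>SS s. \<Union>U\<in>UU s. E S U)"
  have "real (card Bad) \<le> (\<Sum>s=1..L. (1 / 4) ^ s * fact n ^ d)"
  proof -
    have "card Bad \<le> (\<Sum>s=1..L. card (\<Union>S\<in>SS s. \<Union>U\<in>UU s. E S U))"
      unfolding Bad_def by (rule card_UN_le) simp
    also have "\<dots> \<le> (\<Sum>s=1..L. \<Sum>S\<in>SS s. card (\<Union>U\<in>UU s. E S U))"
      by (intro sum_mono card_UN_le fin_SS)
    also have "\<dots> \<le> (\<Sum>s=1..L. \<Sum>S\<in>SS s. \<Sum>U\<in>UU s. card (E S U))"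
      by (intro sum_mono card_UN_le fin_UU)
    finally have "real (card Bad) \<le> (\<Sum>s=1..L. \<Sum>S\<in>SS s. \<Sum>U\<in>UU s. real (card (E S U)))"
      by (simp flip: of_nat_sum)
    also have "\<dots> \<le> (\<Sum>s=1..L. (1 / 4) ^ s * fact n ^ d)"
    proof (rule sum_mono)
      fix s assume s: "s \<in> {1..L}"
      have "(\<Sum>S\<in>SS s. \<Sum>U\<in>UU s. real (card (E S U)))
          \<le> (\<Sum>S\<in>SS s. \<Sum>U\<in>UU s. (real (u s) / real n) ^ (k * s) * fact n ^ d)"
      proof (intro sum_mono)
        fix S U assume "S \<in> SS s" "U \<in> UU s"
        then have SU: "S \<subseteq> {..<d} \<times> {..<n div k}" "card S = s" "U \<subseteq> {..<n}" "card U = u s"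
          by (auto simp: SS_def UU_def slots_def)
        show "real (card (E S U)) \<le> (real (u s) / real n) ^ (k * s) * fact n ^ d"
          using card_matchings_into[OF n SU(1,3)] unfolding E_def \<Omega>_def SU(2,4) .
      qed
      also have "\<dots> = real (card slots choose s) * real (n choose u s)
          * (real (u s) / real n) ^ (k * s) * fact n ^ d"
        using fin_slots by (simp add: SS_def UU_def n_subsets)
      also have "\<dots> \<le> (1 / 4) ^ s * fact n ^ d"
      proof (rule mult_right_mono, rule first_moment_bound)
        show "2 * u s + 3 * s \<le> 2 * k * s"
        proof -
          have "2 * u s \<le> (2 * k - 3) * s" by (simp add: u_def)
          also have "\<dots> = 2 * k * s - 3 * s" by (simp add: diff_mult_distrib)
          finally show ?thesis using mult_right_mono[of 3 "2 * k" s] k by linarith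
        qed
        have "real (n div k) \<le> real n / real k" by (rule of_nat_div_le_of_nat)
        then show "real (card slots) \<le> real d * real n / real k"
          using mult_left_mono[of "real (n div k)" "real n / real k" "real d"] by (simp add: slots_def)
        show "16 * exp 1 ^ (2 * k + 2) * real d ^ 2 * real k * real s \<le> real n"
          using s le_L in_L by simp
      qed (use k d n s in auto)
      finally show "(\<Sum>S\<in>SS s. \<Sum>U\<in>UU s. real (card (E S U))) \<le> (1 / 4) ^ s * fact n ^ d" .
    qed
    finally show ?thesis .
  qed
  also have "\<dots> = (\<Sum>s=1..L. (1 / 4) ^ s) * fact n ^ d"
    by (simp add: sum_distrib_right)
  also have "\<dots> < 1 * fact n ^ d"
    using sum_quarter_powers_less_1 by (intro mult_strict_right_mono) auto
  also have "\<dots> = real (card \<Omega>)" by (simp add: card\<Omega>)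
  finally have "card Bad < card \<Omega>" by simp
  moreover have "Bad \<subseteq> \<Omega>" by (auto simp: Bad_def E_def)
  ultimately obtain w where w: "w \<in> \<Omega>" "w \<notin> Bad"
    by (metis less_irrefl subsetI subset_antisym)
  have perm: "w i permutes {..<n}" if "i < d" for i using w that by (auto simp: \<Omega>_def)
  have "(2 * k - 3) * card S < 2 * card (\<Union>(i, j)\<in>S. w i ` {k * j..<k * j + k})"
    if S: "S \<subseteq> slots" "S \<noteq> {}" "real (card S) \<le> c * real n" for S
  proof (rule ccontr)
    define V where "V = (\<Union>(i, j)\<in>S. w i ` {k * j..<k * j + k})"
    assume "\<not> ?thesis"
    then have small: "card V \<le> u (card S)" by (auto simp: V_def u_def)
    have finS: "finite S" using S fin_slots by (metis finite_subset)
    have V: "V \<subseteq> {..<n}"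
    proof
      fix v assume "v \<in> V"
      then obtain i j x where ij: "(i, j) \<in> S" "x < k * j + k" "v = w i x" by (auto simp: V_def)
      then have ij': "i < d" "Suc j \<le> n div k" using S by (auto simp: slots_def)
      have "k * Suc j \<le> k * (n div k)" using ij' by (intro mult_le_mono2)
      also have "\<dots> \<le> n" by simp
      finally have "x < n" using ij by simp
      then show "v \<in> {..<n}" using ij perm[OF ij'(1)] permutes_in_image by fastforce
    qed
    \<comment> \<open>A union that is too small gets enlarged to exactly \<open>u (card S)\<close>
      variables, so that many must exist; the smallness of \<open>S\<close> guarantees it.\<close>
    have "u (card S) \<le> n"
    proof -
      have "real (u (card S)) \<le> real k * real (card S)"
      proof -
        have "2 * u (card S) \<le> 2 * k * card S"
          unfolding u_def by (rule order_trans[of _ "(2 * k - 3) * card S"]) auto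
        then show ?thesis by (simp flip: of_nat_mult)
      qed
      also have "\<dots> \<le> 16 * exp 1 ^ (2 * k + 2) * real d ^ 2 * (real k * real (card S))"
      proof -
        have "1 * 1 \<le> exp (1::real) ^ (2 * k + 2) * real d ^ 2"
          using d by (intro mult_mono one_le_power) auto
        then have "1 \<le> 16 * exp (1::real) ^ (2 * k + 2) * real d ^ 2" by simp
        then show ?thesis using mult_right_mono[of 1 _ "real k * real (card S)"] by simp
      qed
      also have "\<dots> \<le> real n" using in_L(1)[OF S(3)] by (simp add: mult.assoc)
      finally show ?thesis by simp
    qed
    then obtain U where U: "V \<subseteq> U" "U \<subseteq> {..<n}" "card U = u (card S)"
      using exists_subset_between[OF small _ V] by auto
    have "w \<in> E S U" using w U by (auto simp: E_def V_def)
    moreover have "card S \<in> {1..L}"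
      using finS S in_L(2)[OF S(3)] by (simp add: Suc_le_eq card_gt_0_iff)
    ultimately have "w \<in> Bad" using S U unfolding Bad_def SS_def UU_def by blast
    with w show False by simp
  qed
  then show ?thesis using perm unfolding slots_def by blast
qed

subsection \<open>Negations\<close>

text \<open>Adding the indices one at a time, the best choice of \<open>b i\<close> is at least as good as the
  average one.\<close>

lemma exists_assignment_by_averaging:
  fixes g :: "'i \<Rightarrow> 'a \<Rightarrow> ('b::finite) \<Rightarrow> real"
  assumes J: "finite J" and X: "finite X" and nonneg: "\<And>i x b. 0 \<le> g i x b"
    and avg: "\<And>i x. i \<in> J \<Longrightarrow> x \<in> X \<Longrightarrow> (\<Sum>b\<in>UNIV. g i x b) \<le> \<rho> * real CARD('b)"
  shows "\<exists>b. (\<Sum>x\<in>X. \<Prod>i\<in>J. g i x (b i)) \<le> \<rho> ^ card J * real (card X)"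
  using J avg
proof (induction J rule: finite_induct)
  case empty
  then show ?case by simp
next
  case (insert j J)
  then obtain b where b: "(\<Sum>x\<in>X. \<Prod>i\<in>J. g i x (b i)) \<le> \<rho> ^ card J * real (card X)"
    by (metis insertCI)
  define w where "w x = (\<Prod>i\<in>J. g i x (b i))" for x
  have w: "0 \<le> w x" for x by (simp add: w_def nonneg prod_nonneg)
  \<comment> \<open>The induction hypothesis will be multiplied by \<open>\<rho>\<close>, so its
    sign matters. If \<open>X\<close> is empty, both sides of the claim vanish.\<close>
  have \<rho>: "0 \<le> \<rho>" if X_ne: "X \<noteq> {}"
  proof -
    obtain x where "x \<in> X" using X_ne by blast
    then have "0 \<le> \<rho> * real CARD('b)"
      using insert.prems[of j x] sum_nonneg[of UNIV "g j x"] nonneg by force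
    then show ?thesis by (simp add: zero_le_mult_iff)
  qed
  have "(\<Sum>c\<in>UNIV. \<Sum>x\<in>X. w x * g j x c) = (\<Sum>x\<in>X. w x * (\<Sum>c\<in>UNIV. g j x c))"
    by (subst sum.swap) (simp add: sum_distrib_left)
  also have "\<dots> \<le> (\<Sum>x\<in>X. w x * (\<rho> * real CARD('b)))"
    using insert.prems w by (intro sum_mono mult_left_mono) auto
  also have "\<dots> = (\<Sum>c\<in>(UNIV :: 'b set). \<rho> * (\<Sum>x\<in>X. w x))"
    by (simp add: sum_distrib_right sum_distrib_left mult_ac)
  finally obtain c where c: "(\<Sum>x\<in>X. w x * g j x c) \<le> \<rho> * (\<Sum>x\<in>X. w x)"
    using sum_strict_mono[of UNIV "\<lambda>_. \<rho> * (\<Sum>x\<in>X. w x)" "\<lambda>c. \<Sum>x\<in>X. w x * g j x c"]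
    by (meson UNIV_not_empty finite linorder_not_le)
  have "(\<Sum>x\<in>X. \<Prod>i\<in>insert j J. g i x ((b(j := c)) i)) = (\<Sum>x\<in>X. w x * g j x c)"
  proof (rule sum.cong[OF refl])
    fix x
    have "(\<Prod>i\<in>J. g i x ((b(j := c)) i)) = w x"
      unfolding w_def using insert.hyps by (intro prod.cong) auto
    then show "(\<Prod>i\<in>insert j J. g i x ((b(j := c)) i)) = w x * g j x c"
      using insert.hyps by simp
  qed
  also have "\<dots> \<le> \<rho> ^ card (insert j J) * real (card X)"
  proof (cases "X = {}")
    case False
    then have "\<rho> * (\<Sum>x\<in>X. w x) \<le> \<rho> * (\<rho> ^ card J * real (card X))"
      using b \<rho> by (intro mult_left_mono) (auto simp: w_def)
    then show ?thesis using c insert.hyps by simp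
  qed simp
  finally show ?case by blast
qed

text \<open>The quadratic Taylor lower bound for exp x is inverted, using (1 - x + x^2/2) (1 + x +
  x^2/2) = 1 + x^4/4 \<ge> 1.\<close>

lemma exp_minus_le_quadratic:
  fixes x :: real
  assumes "0 \<le> x"
  shows "exp (- x) \<le> 1 - x + x\<^sup>2 / 2"
proof -
  have "0 < 1 + x + x\<^sup>2 / 2" using assms by (simp add: add_pos_nonneg)
  then have "exp (- x) \<le> 1 / (1 + x + x\<^sup>2 / 2)"
    using exp_lower_Taylor_quadratic[OF assms] by (simp add: exp_minus field_simps)
  also have "\<dots> \<le> 1 - x + x\<^sup>2 / 2"
  proof -
    have "(1 - x + x\<^sup>2 / 2) * (1 + x + x\<^sup>2 / 2) = 1 + (x\<^sup>2 / 2)\<^sup>2"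
      by (simp add: power2_eq_square algebra_simps)
    then have "1 \<le> (1 - x + x\<^sup>2 / 2) * (1 + x + x\<^sup>2 / 2)" by simp
    then show ?thesis using \<open>0 < 1 + x + x\<^sup>2 / 2\<close> by (simp add: divide_le_eq)
  qed
  finally show ?thesis .
qed

text \<open>A derandomised Chernoff bound. Let m be the number of constraints and \<mu> the fraction
  of inputs rejected by \<open>Q\<close>. Over random negations, a factor exp(-\<delta>) per
  violated constraint averages to \<rho> \<le> exp(-\<mu> \<delta> + \<delta>^2/2). Negations no
  worse than average bound the sum over all 2^n assignments; one assignment violating at most (\<mu>
  - \<delta>) m constraints would exceed it when n \<le> \<delta>^2 m / 2.\<close>

lemma exists_negations_violating_many:
  fixes Q :: "('k::finite) predicate" and e :: "'i \<Rightarrow> 'k \<Rightarrow> nat"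
  assumes J: "finite J" and e: "\<And>i l. i \<in> J \<Longrightarrow> e i l < n" and n: "n > 0"
    and \<delta>: "\<delta> > 0" and many: "real n \<le> \<delta>\<^sup>2 / 2 * real (card J)"
  shows "\<exists>b. \<forall>\<sigma> :: nat \<Rightarrow> bool. (real (card {x. \<not> Q x}) / 2 ^ CARD('k) - \<delta>) * real (card J)
      < real (card {i \<in> J. \<not> Q (\<lambda>l. \<sigma> (e i l) \<noteq> b i l)})"
proof -
  define \<mu> where "\<mu> = real (card {x. \<not> Q x}) / 2 ^ CARD('k)"
  define \<rho> where "\<rho> = 1 - \<mu> + \<mu> * exp (- \<delta>)"
  define m where "m = real (card J)"
  define X where "X = {..<n} \<rightarrow>\<^sub>E (UNIV :: bool set)"
  have finX: "finite X" unfolding X_def by (intro finite_PiE) auto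
  have cardX: "card X = 2 ^ n" by (simp add: X_def card_PiE)
  have card_cube: "CARD('k \<Rightarrow> bool) = 2 ^ CARD('k)" by (simp add: card_fun)
  define g where "g i \<sigma> z = (if Q (\<lambda>l. \<sigma> (e i l) \<noteq> z l) then 1 else exp (- \<delta>))"
    for i z and \<sigma> :: "nat \<Rightarrow> bool"
  have avg: "(\<Sum>z\<in>UNIV. g i \<sigma> z) \<le> \<rho> * real CARD('k \<Rightarrow> bool)" for i \<sigma>
  proof -
    \<comment> \<open>Flipping is an involution, so as \<open>z\<close> varies the negated inputs
      run through the whole cube, even if the tuple repeats variables.\<close>
    let ?flip = "\<lambda>z l. \<sigma> (e i l) \<noteq> z l"
    have "bij ?flip" by (rule bij_betw_byWitness[where f' = ?flip]) auto
    then have "(\<Sum>z\<in>UNIV. g i \<sigma> z) = (\<Sum>y\<in>UNIV. if Q y then 1 else exp (- \<delta>))"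
      unfolding g_def by (rule sum.reindex_bij_betw)
    also have "\<dots> = real (card {x. Q x}) + exp (- \<delta>) * real (card {x. \<not> Q x})"
      by (simp add: sum.If_cases Compl_eq)
    also have "real (card {x. Q x}) = 2 ^ CARD('k) - real (card {x. \<not> Q x})"
    proof -
      have "card {x. Q x} + card {x. \<not> Q x} = CARD('k \<Rightarrow> bool)"
        by (subst card_Un_disjoint[symmetric]) (auto intro: arg_cong[where f = card])
      then have "real (card {x. Q x} + card {x. \<not> Q x}) = real (2 ^ CARD('k))"
        unfolding card_cube by simp
      then show ?thesis by simp
    qed
    also have "2 ^ CARD('k) - real (card {x. \<not> Q x}) + exp (- \<delta>) * real (card {x. \<not> Q x})
        = \<rho> * real CARD('k \<Rightarrow> bool)"
      unfolding card_cube by (simp add: \<rho>_def \<mu>_def field_simps)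
    finally show ?thesis by simp
  qed
  have g_nonneg: "0 \<le> g i \<sigma> z" for i \<sigma> z by (simp add: g_def)
  obtain b where b: "(\<Sum>\<sigma>\<in>X. \<Prod>i\<in>J. g i \<sigma> (b i)) \<le> \<rho> ^ card J * real (card X)"
    using exists_assignment_by_averaging[of J X g \<rho>, OF J finX g_nonneg avg] by blast
  have "0 \<le> \<mu>" by (simp add: \<mu>_def)
  have "card {x. \<not> Q x} \<le> CARD('k \<Rightarrow> bool)" by (intro card_mono) auto
  then have "\<mu> \<le> 1" by (simp add: \<mu>_def card_cube flip: of_nat_le_iff)
  have "\<rho> \<le> 1 + \<mu> * (- \<delta> + \<delta>\<^sup>2 / 2)"
    using mult_left_mono[OF exp_minus_le_quadratic[of \<delta>] \<open>0 \<le> \<mu>\<close>] \<delta>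
    by (simp add: \<rho>_def algebra_simps)
  also have "\<dots> \<le> 1 + (- \<mu> * \<delta> + \<delta>\<^sup>2 / 2)"
    using mult_right_mono[OF \<open>\<mu> \<le> 1\<close>, of "\<delta>\<^sup>2 / 2"] by (simp add: algebra_simps)
  also have "\<dots> \<le> exp (- \<mu> * \<delta> + \<delta>\<^sup>2 / 2)" by (rule exp_ge_add_one_self)
  finally have \<rho>_le: "\<rho> \<le> exp (- \<mu> * \<delta> + \<delta>\<^sup>2 / 2)" .
  have \<rho>_nonneg: "0 \<le> \<rho>" using \<open>0 \<le> \<mu>\<close> \<open>\<mu> \<le> 1\<close> by (simp add: \<rho>_def)
  have "\<rho> ^ card J \<le> exp (- \<mu> * \<delta> + \<delta>\<^sup>2 / 2) ^ card J"
    using \<rho>_le \<rho>_nonneg by (rule power_mono)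
  then have \<rho>_pow: "\<rho> ^ card J \<le> exp (m * (- \<mu> * \<delta> + \<delta>\<^sup>2 / 2))"
    by (simp add: m_def exp_of_nat_mult)
  \<comment> \<open>The strict inequality 2 < e, together with \<open>n > 0\<close>, is the source
    of strictness in the conclusion.\<close>
  have "(2::real) < exp 1" using exp_lower_Taylor_quadratic[of "1 :: real"] by simp
  have two_pow: "(2::real) ^ n < exp (real n)"
    using power_strict_mono[OF \<open>2 < exp 1\<close>, of n] n by (simp flip: exp_of_nat_mult)
  have "(\<mu> - \<delta>) * m < real (card {i \<in> J. \<not> Q (\<lambda>l. \<sigma> (e i l) \<noteq> b i l)})"
    for \<sigma> :: "nat \<Rightarrow> bool"
  proof (rule ccontr)
    define V where "V = {i \<in> J. \<not> Q (\<lambda>l. \<sigma> (e i l) \<noteq> b i l)}"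
    assume "\<not> ?thesis"
    then have V: "real (card V) \<le> (\<mu> - \<delta>) * m" by (simp add: V_def)
    \<comment> \<open>Restriction gives all indices from n on a default value and so lands in the
      finite set \<open>X\<close>; the constraints read only variables below n.\<close>
    define \<tau> where "\<tau> = restrict \<sigma> {..<n}"
    have "\<tau> \<in> X" by (simp add: \<tau>_def X_def)
    have "(\<Prod>i\<in>J. g i \<tau> (b i)) = (\<Prod>i\<in>J. if i \<in> V then exp (- \<delta>) else 1)"
    proof (rule prod.cong[OF refl])
      fix i assume i: "i \<in> J"
      then have "(\<lambda>l. \<tau> (e i l) \<noteq> b i l) = (\<lambda>l. \<sigma> (e i l) \<noteq> b i l)" by (simp add: \<tau>_def e)
      then show "g i \<tau> (b i) = (if i \<in> V then exp (- \<delta>) else 1)" using i by (simp add: g_def V_def)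
    qed
    also have "\<dots> = exp (- \<delta>) ^ card V"
    proof -
      have "J \<inter> {i. i \<in> V} = V" by (auto simp: V_def)
      then show ?thesis using J by (simp add: prod.If_cases)
    qed
    also have "\<dots> = exp (- \<delta> * real (card V))" by (simp flip: exp_of_nat2_mult)
    finally have "exp (- \<delta> * real (card V)) = (\<Prod>i\<in>J. g i \<tau> (b i))" by simp
    also have "\<dots> \<le> (\<Sum>\<sigma>\<in>X. \<Prod>i\<in>J. g i \<sigma> (b i))"
      using \<open>\<tau> \<in> X\<close> finX by (intro member_le_sum) (auto simp: g_def intro!: prod_nonneg)
    also have "\<dots> \<le> \<rho> ^ card J * 2 ^ n" using b by (simp add: cardX)
    also have "\<dots> \<le> exp (m * (- \<mu> * \<delta> + \<delta>\<^sup>2 / 2)) * 2 ^ n"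
      using \<rho>_pow by (rule mult_right_mono) simp
    also have "\<dots> < exp (m * (- \<mu> * \<delta> + \<delta>\<^sup>2 / 2)) * exp (real n)"
      using two_pow by (rule mult_strict_left_mono) simp
    also have "\<dots> = exp (m * (- \<mu> * \<delta> + \<delta>\<^sup>2 / 2) + real n)" by (simp add: exp_add)
    finally have "- \<delta> * real (card V) < m * (- \<mu> * \<delta> + \<delta>\<^sup>2 / 2) + real n" by simp
    moreover have "\<delta> * real (card V) \<le> \<delta> * ((\<mu> - \<delta>) * m)"
      using V \<delta> by (intro mult_left_mono) auto
    moreover have "\<delta> * ((\<mu> - \<delta>) * m) = m * \<mu> * \<delta> - \<delta>\<^sup>2 * m"
      by (simp add: power2_eq_square algebra_simps)
    moreover have "m * (- \<mu> * \<delta> + \<delta>\<^sup>2 / 2) = - (m * \<mu> * \<delta>) + \<delta>\<^sup>2 / 2 * m"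
      by (simp add: algebra_simps)
    ultimately show False using many unfolding m_def by simp
  qed
  then show ?thesis unfolding \<mu>_def m_def by blast
qed

subsection \<open>The lower bound\<close>

text \<open>Blocks of sparse partitions give the tuples, averaging with \<epsilon>/2 gives the
  negations, and the other \<epsilon>/2 pays for rounding n / k down. Of the bounds on n, the first
  lets sparsity apply to pairs of blocks, the second leaves at least d n / (2k) constraints, and the
  third limits the rounding loss.\<close>

lemma exists_hard_instance:
  fixes P Q :: "('k::finite) predicate"
  assumes k: "CARD('k) \<ge> 3" and sym: "symmetric_predicate P"
    and ne: "card {x. P x} > 0" and nEQU: "P \<noteq> EQU"
    and \<epsilon>: "\<epsilon> > 0" and d: "16 * real CARD('k) / \<epsilon>\<^sup>2 \<le> real d"
    and c: "c = 1 / (16 * exp 1 ^ (2 * CARD('k) + 2) * real d ^ 2 * real CARD('k))"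
    and n: "2 \<le> c * real n" "2 * CARD('k) \<le> n" "2 * real CARD('k) \<le> \<epsilon> * real n"
  shows "\<exists>I\<in>csp_instances d n. inj_on fst (constraints I) \<and>
    far_from_satisfiable Q (real (card {x. \<not> Q x}) / 2 ^ CARD('k) - \<epsilon>) d n I \<and>
    (\<forall>S\<subseteq>constraints I. real (card S) \<le> c * real n \<longrightarrow> satisfiable P S)"
proof -
  define k where "k = CARD('k)"
  have k3: "k \<ge> 3" using k by (simp add: k_def)
  have n_pos: "n > 0" using n(2) k by simp
  have "0 < 16 * real CARD('k) / \<epsilon>\<^sup>2" using \<epsilon> k by simp
  then have d_pos: "d > 0" using d by linarith
  define slots where "slots = {..<d} \<times> {..<n div k}"
  have fin_slots: "finite slots" by (simp add: slots_def)
  obtain w where perm: "\<And>i. i < d \<Longrightarrow> w i permutes {..<n}"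
    and sparse: "\<And>S. S \<subseteq> slots \<Longrightarrow> S \<noteq> {} \<Longrightarrow> real (card S) \<le> c * real n \<Longrightarrow>
       (2 * k - 3) * card S < 2 * card (\<Union>(i, j)\<in>S. w i ` {k * j..<k * j + k})"
    using exists_sparse_matchings[OF k3 d_pos n_pos c[folded k_def], folded slots_def] by blast
  obtain idx :: "'k \<Rightarrow> nat" where "bij_betw idx UNIV {0..<k}"
    unfolding k_def using ex_bij_betw_finite_nat[of "UNIV :: 'k set"] by auto
  then have idx: "inj idx" "range idx = {0..<k}" by (auto simp: bij_betw_def)
  have idx_less: "idx l < k" for l using idx(2) by (metis atLeastLessThan_iff rangeI)
  define e where "e p l = w (fst p) (k * snd p + idx l)" for p l
  have range_e: "range (e (i, j)) = w i ` {k * j..<k * j + k}" for i j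
  proof -
    have "range (e (i, j)) = w i ` (+) (k * j) ` range idx" unfolding e_def by auto
    also have "(+) (k * j) ` range idx = {k * j..<k * j + k}" unfolding idx(2) by (simp add: add.commute)
    finally show ?thesis .
  qed
  have blocks: "(\<Union>(i, j)\<in>S. w i ` {k * j..<k * j + k}) = (\<Union>p\<in>S. range (e p))" for S
  proof -
    have "(\<lambda>(i, j). w i ` {k * j..<k * j + k}) = (\<lambda>p. range (e p))"
    proof (rule ext)
      fix p :: "nat \<times> nat"
      obtain i j where p: "p = (i, j)" by fastforce
      show "(case p of (i, j) \<Rightarrow> w i ` {k * j..<k * j + k}) = range (e p)"
        unfolding p prod.case range_e by (rule refl)
    qed
    then show ?thesis by (simp only:)
  qed
  have w_inj: "inj (w i)" if "i < d" for i using perm[OF that] by (rule permutes_inj)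
  have inj_e: "inj (e p)" if "p \<in> slots" for p
  proof (rule injI)
    fix l l' assume eq: "e p l = e p l'"
    have "inj (w (fst p))" using that w_inj by (auto simp: slots_def)
    then show "l = l'" using eq by (simp add: e_def inj_eq idx(1))
  qed
  have e_less: "e p l < n" if p_slot: "p \<in> slots" for p l
  proof -
    obtain i j where p: "p = (i, j)" "i < d" "j < n div k"
      using p_slot by (auto simp: slots_def)
    have "k * Suc j \<le> k * (n div k)" using p by (intro mult_le_mono2) simp
    also have "\<dots> \<le> n" by simp
    finally have "k * j + idx l < n" using idx_less[of l] by simp
    then show ?thesis using permutes_in_image[OF perm[OF p(2)]] by (simp add: e_def p)
  qed
  define m where "m = real (card slots)"
  have m_ge: "real d * (real n / real k - 1) \<le> m"
  proof -
    have "n \<le> k * (n div k) + k"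
      using mod_less_divisor[of k n] mult_div_mod_eq[of k n] k3 by linarith
    then have "real n \<le> real k * real (n div k) + real k"
      by (simp flip: of_nat_mult of_nat_add)
    then have "real n / real k - 1 \<le> real (n div k)"
      using k3 by (simp add: field_simps)
    then show ?thesis by (simp add: m_def slots_def mult_left_mono)
  qed
  \<comment> \<open>The 16 in the degree bound is calibrated here: at least d n / (2k) slots give m
    \<epsilon>^2 \<ge> 8 n, and (\<epsilon>/2)^2 / 2 = \<epsilon>^2 / 8.\<close>
  have "real n \<le> (\<epsilon> / 2)\<^sup>2 / 2 * real (card slots)"
  proof -
    have "8 * real n = 16 * real k / \<epsilon>\<^sup>2 * (real n / (2 * real k)) * \<epsilon>\<^sup>2"
      using \<epsilon> k3 by simp
    also have "\<dots> \<le> real d * (real n / real k - 1) * \<epsilon>\<^sup>2"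
    proof (intro mult_right_mono mult_mono)
      show "real n / (2 * real k) \<le> real n / real k - 1"
      proof -
        have "1 * (2 * real k) \<le> real n" using n(2) unfolding k_def by linarith
        then have "1 \<le> real n / (2 * real k)" using k3 by (subst le_divide_eq) simp
        then show ?thesis by simp
      qed
    qed (use d in \<open>auto simp: k_def\<close>)
    also have "\<dots> \<le> m * \<epsilon>\<^sup>2" using m_ge by (rule mult_right_mono) simp
    finally show ?thesis by (simp add: m_def power_divide field_simps)
  qed
  then obtain b where b: "\<And>\<sigma> :: nat \<Rightarrow> bool. (real (card {x. \<not> Q x}) / 2 ^ CARD('k) - \<epsilon> / 2) * m
      < real (card {p \<in> slots. \<not> Q (\<lambda>l. \<sigma> (e p l) \<noteq> b p l)})"
    using exists_negations_violating_many[of slots e n "\<epsilon> / 2" Q, OF fin_slots e_less n_pos] \<epsilon>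
    unfolding m_def by auto
  define con where "con p = (e p, b p)" for p
  have vars_con: "constr_vars (con p) = range (e p)" for p by (simp add: con_def constr_vars_def)
  \<comment> \<open>Two slots with the same tuple would cover only k variables, whereas sparsity of
    the pair demands more than 2k - 3 \<ge> k.\<close>
  have e_eq: "p = p'" if p: "p \<in> slots" "p' \<in> slots" and eq: "e p = e p'" for p p'
  proof (rule ccontr)
    assume "p \<noteq> p'"
    then have "real (card {p, p'}) \<le> c * real n" using n(1) by simp
    then have "(2 * k - 3) * card {p, p'} < 2 * card (\<Union>(i, j)\<in>{p, p'}. w i ` {k * j..<k * j + k})"
      using p by (intro sparse) auto
    also have "(\<Union>(i, j)\<in>{p, p'}. w i ` {k * j..<k * j + k}) = (\<Union>q\<in>{p, p'}. range (e q))"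
      by (rule blocks)
    also have "\<dots> = range (e p)" using eq by simp
    also have "card (range (e p)) = k" using card_image[OF inj_e[OF p(1)]] by (simp add: k_def)
    finally show False using \<open>p \<noteq> p'\<close> k3 by simp
  qed
  have inj_con: "inj_on con slots" using e_eq by (auto intro!: inj_onI simp: con_def)
  define C where "C = con ` slots"
  have finC: "finite C" using fin_slots by (simp add: C_def)
  have "\<forall>x. \<exists>xs. set xs = {c \<in> C. x \<in> constr_vars c} \<and> distinct xs"
    using finC by (auto intro!: finite_distinct_list)
  then obtain inc where inc: "\<And>x. set (inc x) = {c \<in> C. x \<in> constr_vars c}" "\<And>x. distinct (inc x)"
    by metis
  define I where "I = \<lparr>constraints = C, incidence = inc\<rparr>"
  \<comment> \<open>In each partition at most one block contains \<open>x\<close>, so a slot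
    containing \<open>x\<close> is determined by its first component.\<close>
  have degree: "card {c \<in> C. x \<in> constr_vars c} \<le> d" for x
  proof -
    define B where "B = {p \<in> slots. x \<in> range (e p)}"
    have finB: "finite B" using fin_slots by (simp add: B_def)
    have "inj_on fst B"
    proof (rule inj_onI)
      fix p p' assume p: "p \<in> B" "p' \<in> B" "fst p = fst p'"
      then obtain l l' where "e p l = x" "e p' l' = x" by (auto simp: B_def)
      then have "w (fst p) (k * snd p + idx l) = w (fst p) (k * snd p' + idx l')"
        using p by (simp add: e_def)
      moreover have "fst p < d" using p by (auto simp: B_def slots_def)
      ultimately have "k * snd p + idx l = k * snd p' + idx l'"
        using injD[OF w_inj] by blast
      then have "(k * snd p + idx l) div k = (k * snd p' + idx l') div k" by simp
      then have "snd p = snd p'" using idx_less k3 by simp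
      then show "p = p'" using p by (simp add: prod_eq_iff)
    qed
    have "{c \<in> C. x \<in> constr_vars c} = con ` B" by (auto simp: C_def B_def vars_con)
    then have "card {c \<in> C. x \<in> constr_vars c} \<le> card B" using finB by (simp add: card_image_le)
    also have "\<dots> = card (fst ` B)" using \<open>inj_on fst B\<close> by (simp add: card_image)
    also have "\<dots> \<le> card {..<d}" by (intro card_mono) (auto simp: B_def slots_def)
    finally show ?thesis by simp
  qed
  have "I \<in> csp_instances d n"
    unfolding csp_instances_def I_def
    using inc degree e_less by (auto simp: C_def vars_con)
  moreover have "inj_on fst (constraints I)"
  proof (rule inj_onI)
    fix a a' assume "a \<in> constraints I" "a' \<in> constraints I" and eq: "fst a = fst a'"
    then obtain p p' where p: "p \<in> slots" "p' \<in> slots" "a = con p" "a' = con p'"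
      by (auto simp: I_def C_def)
    then have "p = p'" using eq by (intro e_eq) (simp_all add: con_def)
    then show "a = a'" using p by simp
  qed
  moreover have "far_from_satisfiable Q (real (card {x. \<not> Q x}) / 2 ^ CARD('k) - \<epsilon>) d n I"
    unfolding far_from_satisfiable_def
  proof (intro allI impI)
    fix R assume R: "R \<subseteq> constraints I" "satisfiable Q (constraints I - R)"
    define \<mu> where "\<mu> = real (card {x. \<not> Q x}) / 2 ^ CARD('k)"
    have "card {x. \<not> Q x} \<le> CARD('k \<Rightarrow> bool)" by (intro card_mono) auto
    then have \<mu>1: "\<mu> \<le> 1" by (simp add: \<mu>_def card_fun flip: of_nat_le_iff)
    obtain \<sigma> where \<sigma>: "\<And>c. c \<in> C - R \<Longrightarrow> satisfies Q \<sigma> c"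
      using R(2) unfolding satisfiable_def I_def by auto
    \<comment> \<open>Every constraint violated by \<open>\<sigma>\<close> must have been removed,
      so the count of violations bounds \<open>card R\<close> from below.\<close>
    define W where "W = {p \<in> slots. \<not> Q (\<lambda>l. \<sigma> (e p l) \<noteq> b p l)}"
    have "con ` W \<subseteq> R"
      using \<sigma> by (force simp: W_def C_def satisfies_def con_def)
    moreover have "finite R" using R(1) finC finite_subset by (auto simp: I_def)
    ultimately have "card (con ` W) \<le> card R" by (intro card_mono)
    moreover have "card (con ` W) = card W"
      by (intro card_image inj_on_subset[OF inj_con]) (auto simp: W_def)
    ultimately have W: "(\<mu> - \<epsilon> / 2) * m < real (card R)"
      using b[of \<sigma>] unfolding W_def \<mu>_def by linarith
    \<comment> \<open>For \<mu> \<le> \<epsilon> the required number is not positive. Otherwise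
      rounding costs at most d constraints, which is at most \<epsilon>/2 times d n / k.\<close>
    have "(\<mu> - \<epsilon>) * real d * real n / real k \<le> real (card R)"
    proof (cases "\<mu> \<le> \<epsilon>")
      case True
      then have "(\<mu> - \<epsilon>) * real d * real n / real k \<le> 0"
        by (intro divide_nonpos_nonneg mult_nonpos_nonneg) auto
      then show ?thesis by linarith
    next
      case False
      have "(\<mu> - \<epsilon> / 2) * real d \<le> 1 * real d" using \<mu>1 \<epsilon> by (intro mult_right_mono) auto
      also have "\<dots> \<le> (\<epsilon> / 2 * (real n / real k)) * real d"
        using n(3) k3 unfolding k_def[symmetric] by (intro mult_right_mono) (auto simp: field_simps)
      finally have "(\<mu> - \<epsilon>) * real d * real n / real k \<le> (\<mu> - \<epsilon> / 2) * (real d * (real n / real k - 1))"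
        by (simp add: algebra_simps diff_divide_distrib)
      also have "\<dots> \<le> (\<mu> - \<epsilon> / 2) * m" using m_ge False \<epsilon> by (intro mult_left_mono) auto
      finally show ?thesis using W by linarith
    qed
    then show "(real (card {x. \<not> Q x}) / 2 ^ CARD('k) - \<epsilon>) * real d * real n / real CARD('k)
        \<le> real (card R)"
      by (simp only: \<mu>_def k_def)
  qed
  moreover have "satisfiable P S" if S: "S \<subseteq> constraints I" "real (card S) \<le> c * real n" for S
  proof (rule satisfiable_by_peeling[OF k sym ne nEQU])
    have SC: "S \<subseteq> C" using S by (simp add: I_def)
    show finS: "finite S" using SC finC by (rule finite_subset)
    show inj_S: "inj (fst c)" if "c \<in> S" for c
      using that SC inj_e by (auto simp: C_def con_def)
    fix T assume T: "T \<subseteq> S" "T \<noteq> {}"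
    obtain T' where T': "T' \<subseteq> slots" "T = con ` T'"
      using T(1) SC unfolding C_def by (meson order_trans subset_imageE)
    have card_T: "card T = card T'"
      unfolding T'(2) by (intro card_image inj_on_subset[OF inj_con T'(1)])
    have "card T \<le> card S" using T(1) finS by (intro card_mono)
    then have "real (card T') \<le> c * real n" using S(2) card_T by linarith
    then have "(2 * k - 3) * card T' < 2 * card (\<Union>(i, j)\<in>T'. w i ` {k * j..<k * j + k})"
      using T T' by (intro sparse) auto
    also have "(\<Union>(i, j)\<in>T'. w i ` {k * j..<k * j + k}) = (\<Union>c\<in>T. constr_vars c)"
      unfolding T'(2) image_image vars_con by (rule blocks)
    finally have spread: "(2 * CARD('k) - 3) * card T < 2 * card (\<Union>c\<in>T. constr_vars c)"
      unfolding card_T k_def .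
    show "\<exists>c\<in>T. card (fst c -` (\<Union>c'\<in>T - {c}. constr_vars c')) \<le> 2"
    proof (rule exists_constraint_with_two_shared_variables[OF _ _ spread])
      show "finite T" using T(1) finS by (rule finite_subset)
      show "inj (fst c)" if "c \<in> T" for c using that T(1) inj_S by blast
    qed
  qed
  ultimately show ?thesis by blast
qed

theorem theorem3:
  fixes P :: "('k::finite) predicate"
  assumes "CARD('k) \<ge> 3"
    and "symmetric_predicate P"
    and "card {x. P x} > 0"
    and "P \<noteq> EQU"
  shows "\<exists>C::real. \<forall>\<epsilon>::real. \<epsilon> > 0 \<longrightarrow>
    (\<forall>Q :: 'k predicate. {x. P x} \<subseteq> {x. Q x} \<longrightarrow>
      (\<exists>d::nat. d > 0 \<and> real d \<le> C * max 1 (1 / \<epsilon>^2) \<and>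
        (\<exists>c::real. c > 0 \<and> (\<exists>N::nat. \<forall>n\<ge>N. \<forall>A :: 'k decision_tree pmf.
          one_sided_tester Q (real (card {x. \<not> Q x}) / 2 ^ CARD('k) - \<epsilon>) d n A \<longrightarrow>
          ereal (c * real n) \<le> ereal_of_enat (query_complexity d n A)))))"
proof (intro exI[of _ "16 * real CARD('k) + 1"] allI impI)
  fix \<epsilon> :: real and Q :: "'k predicate"
  assume \<epsilon>: "\<epsilon> > 0" and PQ: "{x. P x} \<subseteq> {x. Q x}"
  let ?k = "real CARD('k)"
  define d where "d = nat \<lceil>16 * ?k / \<epsilon>\<^sup>2\<rceil>"
  define c where "c = 1 / (16 * exp 1 ^ (2 * CARD('k) + 2) * real d ^ 2 * ?k)"
  have pos: "0 < 16 * ?k / \<epsilon>\<^sup>2" using \<epsilon> assms(1) by simp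
  then have d_ge: "16 * ?k / \<epsilon>\<^sup>2 \<le> real d" and d_pos: "d > 0"
    unfolding d_def by (simp_all add: real_nat_ceiling_ge)
  have c_pos: "c > 0" using d_pos assms(1) by (simp add: c_def)
  \<comment> \<open>Rounding up adds at most 1, which the maximum absorbs; hence the constant 16 k +
    1.\<close>
  have "real d \<le> 16 * ?k / \<epsilon>\<^sup>2 + 1"
    using pos unfolding d_def by (simp add: of_nat_nat)
  also have "\<dots> = 16 * ?k * (1 / \<epsilon>\<^sup>2) + 1 * 1" by simp
  also have "\<dots> \<le> 16 * ?k * max 1 (1 / \<epsilon>\<^sup>2) + 1 * max 1 (1 / \<epsilon>\<^sup>2)"
    by (intro add_mono mult_left_mono) auto
  also have "\<dots> = (16 * ?k + 1) * max 1 (1 / \<epsilon>\<^sup>2)" by (simp only: distrib_right)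
  finally have d_le: "real d \<le> (16 * ?k + 1) * max 1 (1 / \<epsilon>\<^sup>2)" .
  obtain x0 where "P x0" using assms(3) by (metis Collect_empty_eq card.empty less_irrefl)
  then have x0: "Q x0" using PQ by auto
  \<comment> \<open>One summand for each of the three lower bounds on n in
    \<open>exists_hard_instance\<close>.\<close>
  define N where "N = nat \<lceil>2 / c\<rceil> + 2 * CARD('k) + nat \<lceil>2 * ?k / \<epsilon>\<rceil>"
  have "ereal (c * real n) \<le> ereal_of_enat (query_complexity d n A)"
    if n: "n \<ge> N" and A: "one_sided_tester Q (real (card {x. \<not> Q x}) / 2 ^ CARD('k) - \<epsilon>) d n A"
    for n and A :: "'k decision_tree pmf"
  proof -
    have "2 / c \<le> real n" "2 * ?k / \<epsilon> \<le> real n" and n2: "2 * CARD('k) \<le> n"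
      using n real_nat_ceiling_ge[of "2 / c"] real_nat_ceiling_ge[of "2 * ?k / \<epsilon>"]
      unfolding N_def by linarith+
    then have n1: "2 \<le> c * real n" and n3: "2 * ?k \<le> \<epsilon> * real n"
      using c_pos \<epsilon> by (simp_all add: divide_le_eq mult.commute)
    obtain I where I: "I \<in> csp_instances d n" "inj_on fst (constraints I)"
      "far_from_satisfiable Q (real (card {x. \<not> Q x}) / 2 ^ CARD('k) - \<epsilon>) d n I"
      and sat: "\<And>S. S \<subseteq> constraints I \<Longrightarrow> real (card S) \<le> c * real n \<Longrightarrow> satisfiable P S"
      using exists_hard_instance[where Q = Q, OF assms \<epsilon> d_ge c_def n1 n2 n3] by blast
    \<comment> \<open>An assignment satisfying the constraints for \<open>P\<close> satisfies them
      for the weaker \<open>Q\<close>.\<close>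
    have "satisfiable Q S" if "S \<subseteq> constraints I" "card S \<le> nat \<lfloor>c * real n\<rfloor>" for S
    proof -
      have "real (card S) \<le> c * real n" using that(2) n1 by linarith
      then show ?thesis
        using sat[OF that(1)] PQ unfolding satisfiable_def satisfies_def by blast
    qed
    then obtain t where t: "t \<in> set_pmf A" "nat \<lfloor>c * real n\<rfloor> < num_queries (oracle_of I) t"
      using one_sided_tester_many_queries[OF I _ x0 A, of "nat \<lfloor>c * real n\<rfloor>"] by blast
    \<comment> \<open>Exceeding the floor of c n by at least one query already gives at least c n
      queries.\<close>
    have "ereal (c * real n) \<le> ereal_of_enat (enat (num_queries (oracle_of I) t))"
      using t(2) by simp linarith
    also have "enat (num_queries (oracle_of I) t) \<le> query_complexity d n A"
      unfolding query_complexity_def using t(1) I(1) by (meson SUP_upper2 order_refl)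
    finally show ?thesis by simp
  qed
  then show "\<exists>d::nat. d > 0 \<and> real d \<le> (16 * ?k + 1) * max 1 (1 / \<epsilon>^2) \<and>
        (\<exists>c::real. c > 0 \<and> (\<exists>N::nat. \<forall>n\<ge>N. \<forall>A :: 'k decision_tree pmf.
          one_sided_tester Q (real (card {x. \<not> Q x}) / 2 ^ CARD('k) - \<epsilon>) d n A \<longrightarrow>
          ereal (c * real n) \<le> ereal_of_enat (query_complexity d n A)))"
    using d_pos d_le c_pos by blast
qed

end
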